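(* Let $d\ge 5$ and let $h,g$ be distinct $d$-uniform hypergraphs on the same vertex set with $\mathrm{Proj}(h)=\mathrm{Proj}(g)$ and $e(h)\ge e(g)$. Then $d-1-\frac{1}{m(h)}\ge\frac{2d-4}{2d-1}$.
   Context: $\mathrm{Proj}(H)$ is the graph on the vertex set of $H$ with $\{i,j\}$ an edge iff some hyperedge contains $\{i,j\}$. $e(\cdot)$ and $v(\cdot)$ are numbers of hyperedges and vertices; $m(H)=\max_{K\subseteq H} e(K)/v(K)$ over subhypergraphs $K$ of $H$. *)

theory Defs
  imports Complex_Main
begin

text \<open>
  Finite hypergraphs without repeated hyperedges. A graph is represented as a hypergraph
  all of whose hyperedges have exactly two elements.
\<close>

record 'a hypergraph =
  verts :: "'a set"
  hedges :: "'a set set"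

definition hypergraph :: "'a hypergraph \<Rightarrow> bool" where
  "hypergraph H \<longleftrightarrow> finite (verts H) \<and> (\<forall>e\<in>hedges H. e \<subseteq> verts H)"

definition uniform_hypergraph :: "nat \<Rightarrow> 'a hypergraph \<Rightarrow> bool" where
  "uniform_hypergraph d H \<longleftrightarrow> hypergraph H \<and> (\<forall>e\<in>hedges H. card e = d)"

definition num_verts :: "'a hypergraph \<Rightarrow> nat" where
  "num_verts H = card (verts H)"

definition num_edges :: "'a hypergraph \<Rightarrow> nat" where
  "num_edges H = card (hedges H)"

definition Proj :: "'a hypergraph \<Rightarrow> 'a hypergraph" where
  "Proj H = \<lparr>verts = verts H,
             hedges = {{i, j} | i j. i \<noteq> j \<and> (\<exists>e\<in>hedges H. {i, j} \<subseteq> e)}\<rparr>"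

definition subhypergraph :: "'a hypergraph \<Rightarrow> 'a hypergraph \<Rightarrow> bool" where
  "subhypergraph K H \<longleftrightarrow> hypergraph K \<and> verts K \<subseteq> verts H \<and> hedges K \<subseteq> hedges H"

text \<open>
  Subhypergraphs without vertices are excluded, so that every quotient is meaningful.
  The maximum is well-defined as soon as the hypergraph has a vertex.
\<close>

definition max_density :: "'a hypergraph \<Rightarrow> real" where
  "max_density H =
     Max {real (num_edges K) / real (num_verts K) | K. subhypergraph K H \<and> verts K \<noteq> {}}"

lemma finite_subhypergraphs:
  assumes "hypergraph H"
  shows "finite {K. subhypergraph K H}"
proof (rule finite_subset)
  show "{K. subhypergraph K H} \<subseteq>
      (\<lambda>(V, E). \<lparr>verts = V, hedges = E\<rparr>) ` (Pow (verts H) \<times> Pow (hedges H))"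
  proof
    fix K assume "K \<in> {K. subhypergraph K H}"
    then have "(verts K, hedges K) \<in> Pow (verts H) \<times> Pow (hedges H)"
      by (simp add: subhypergraph_def)
    then show "K \<in> (\<lambda>(V, E). \<lparr>verts = V, hedges = E\<rparr>) ` (Pow (verts H) \<times> Pow (hedges H))"
      by (rule rev_image_eqI) simp
  qed
  have "hedges H \<subseteq> Pow (verts H)" "finite (verts H)"
    using assms by (auto simp: hypergraph_def)
  then show "finite ((\<lambda>(V, E). \<lparr>verts = V, hedges = E\<rparr>) ` (Pow (verts H) \<times> Pow (hedges H)))"
    by (meson finite_Pow_iff finite_SigmaI finite_imageI finite_subset)
qed

end

theory Submission
  imports Defs
begin

text \<open>
  Let \<open>A = h - g\<close>, \<open>B = g - h\<close>, let \<open>W\<close> be the set of vertices covered by \<open>A \<union> B\<close>, and let \<open>C\<close>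
  be the set of common hyperedges meeting \<open>W\<close> in at least two vertices. The subhypergraph of \<open>h\<close>
  with hyperedges \<open>A \<union> C\<close> is dense enough. A pair of vertices lying in a hyperedge of \<open>A\<close> but in
  none of \<open>B\<close>, or conversely, must lie in a hyperedge of \<open>C\<close>, so \<open>C\<close> is large unless \<open>A\<close> and \<open>B\<close>
  cover nearly the same pairs. This is quantified by a discharging argument: every hyperedge of
  \<open>A \<union> B\<close> distributes the same budget among its vertices, every such pair containing \<open>x\<close> adds \<open>3/2\<close> to
  \<open>x\<close>, and each vertex of \<open>W\<close> ends up with at least \<open>2 d - 1\<close>. The inequality
  \<open>card B \<le> card A\<close> then turns the total budget of \<open>A \<union> B\<close> into a bound in terms of \<open>A\<close> alone.
\<close>

section \<open>Links, discrepancy and the division of the budgets\<close>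

definition star :: "'a set set \<Rightarrow> 'a \<Rightarrow> 'a set set" where
  "star F x = {e \<in> F. x \<in> e}"

definition link :: "'a set set \<Rightarrow> 'a \<Rightarrow> 'a set" where
  "link F x = \<Union>(star F x) - {x}"

definition discrepancy :: "'a set set \<Rightarrow> 'a set set \<Rightarrow> 'a \<Rightarrow> 'a set" where
  "discrepancy F G x = (link F x - link G x) \<union> (link G x - link F x)"

text \<open>
  The tight vertices are those for which an equal split of the budget fails when \<open>d > 5\<close>. In the
  extremal configuration, where \<open>A\<close> and \<open>B\<close> consist of one hyperedge each and these share \<open>d - 1\<close>
  vertices, all shared vertices are tight.
\<close>

definition tight :: "'a set set \<Rightarrow> 'a set set \<Rightarrow> 'a set \<Rightarrow> 'a set" where
  "tight F G e = {x \<in> e. star F x = {e} \<and> (\<exists>f. star G x = {f} \<and> Suc (card (e \<inter> f)) = card e)}"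

text \<open>
  A tight vertex receives the least amount it needs; the remaining vertices share the rest of the
  budget \<open>(2 d\<^sup>2 - 5 d + 5) / 2\<close> equally.
\<close>

definition share :: "'a set set \<Rightarrow> 'a set set \<Rightarrow> 'a set \<Rightarrow> 'a \<Rightarrow> real" where
  "share F G e x =
     (if x \<in> tight F G e then real (card e) - 2
      else real (card e) - 2 - (real (card e) - 5) / (2 * (real (card e) - real (card (tight F G e)))))"

lemma tight_subset: "tight F G e \<subseteq> e"
  by (auto simp: tight_def)

lemma star_singletonD:
  assumes "star F x = {e}"
  shows "e \<in> F" "x \<in> e" "f \<in> F \<Longrightarrow> x \<in> f \<Longrightarrow> f = e"
proof -
  have "e \<in> star F x" using assms by simp
  then show "e \<in> F" "x \<in> e" by (simp_all add: star_def)
  assume "f \<in> F" "x \<in> f"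
  then have "f \<in> star F x" by (simp add: star_def)
  then show "f = e" using assms by simp
qed

lemma discrepancy_commute: "discrepancy F G x = discrepancy G F x"
  by (auto simp: discrepancy_def)

section \<open>Tight vertices of a hyperedge\<close>

locale uniform_pair =
  fixes d :: nat and A B :: "'a set set"
  assumes d_ge: "d \<ge> 5"
    and fin: "finite A" "finite B"
    and unifA: "e \<in> A \<Longrightarrow> card e = d"
    and unifB: "e \<in> B \<Longrightarrow> card e = d"
    and disj: "A \<inter> B = {}"
begin

text \<open>The locale hypotheses are symmetric, so every fact about hyperedges of \<open>A\<close>
  transfers to \<open>B\<close>. Equality of the projections and \<open>card B \<le> card A\<close>
  enter only in the final theorem.\<close>

lemma swap: "uniform_pair d B A"
proof
  show "5 \<le> d" "finite B" "finite A" by (fact d_ge fin)+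
  show "card e = d" if "e \<in> B" for e using that by (rule unifB)
  show "card e = d" if "e \<in> A" for e using that by (rule unifA)
  show "B \<inter> A = {}" using disj by blast
qed

lemma finite_edge:
  assumes "e \<in> A \<union> B"
  shows "finite e"
proof -
  have "card e = d" using assms unifA unifB by blast
  then have "card e > 0" using d_ge by linarith
  then show ?thesis by (rule card_ge_0_finite)
qed

lemma finite_star: "finite (star A x)" "finite (star B x)"
  using fin by (auto simp: star_def)

lemma finite_link: "finite (link A x)" "finite (link B x)"
proof -
  have "finite (\<Union>(star A x))" by (rule finite_Union[OF finite_star(1)]) (simp add: star_def finite_edge)
  then show "finite (link A x)" by (simp add: link_def)
  have "finite (\<Union>(star B x))" by (rule finite_Union[OF finite_star(2)]) (simp add: star_def finite_edge)
  then show "finite (link B x)" by (simp add: link_def)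
qed

lemma finite_discrepancy: "finite (discrepancy A B x)"
  using finite_link by (auto simp: discrepancy_def)

lemma finite_tight: "e \<in> A \<Longrightarrow> finite (tight A B e)"
  by (rule finite_subset[OF tight_subset finite_edge]) simp

lemma tightE:
  assumes "e \<in> A" "x \<in> tight A B e"
  obtains f y where "x \<in> e" "star A x = {e}" "star B x = {f}" "e - f = {y}"
proof -
  obtain f where f: "x \<in> e" "star A x = {e}" "star B x = {f}" "Suc (card (e \<inter> f)) = card e"
    using assms(2) unfolding tight_def by blast
  have "finite e" using finite_edge assms(1) by blast
  then have "card (e - f) = card e - card (e \<inter> f)"
    by (simp add: card_Diff_subset_Int)
  then have "card (e - f) = 1" using f(4) by linarith
  then obtain y where "e - f = {y}" by (rule card_1_singletonE)
  with f(1-3) show ?thesis by (rule that)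
qed

text \<open>Tightness of \<open>x\<close> makes \<open>e - f\<close> equal to \<open>{y}\<close>.
  The \<open>B\<close>-hyperedge \<open>f'\<close> at \<open>y\<close> differs from
  \<open>f\<close>, so it misses \<open>x\<close>, and \<open>e - f'\<close> is \<open>{x}\<close>.
  A third tight vertex would lie in both \<open>f\<close> and \<open>f'\<close>, although only one
  hyperedge of \<open>B\<close> contains it.\<close>

lemma tight_subset_pair:
  assumes e: "e \<in> A" and x: "x \<in> tight A B e" and f: "star B x = {f}" and y: "y \<in> tight A B e" "y \<notin> f"
  shows "tight A B e \<subseteq> {x, y}"
proof
  fix z assume z: "z \<in> tight A B e"
  obtain f1 u where f1: "x \<in> e" "star A x = {e}" "star B x = {f1}" "e - f1 = {u}"
    by (rule tightE[OF e x])
  obtain f' v where f': "y \<in> e" "star A y = {e}" "star B y = {f'}" "e - f' = {v}"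
    by (rule tightE[OF e y(1)])
  obtain f'' w where f'': "z \<in> e" "star A z = {e}" "star B z = {f''}" "e - f'' = {w}"
    by (rule tightE[OF e z])
  have "f1 = f" using f f1 by simp
  have "y \<in> e - f1" using f'(1) y(2) \<open>f1 = f\<close> by simp
  then have "u = y" using f1(4) by simp
  have mem: "f \<in> B" "f' \<in> B" "y \<in> f'"
    using star_singletonD(1)[OF f] star_singletonD(1,2)[OF f'(3)] by simp_all
  then have "f \<noteq> f'" using y by blast
  then have "x \<notin> f'" using star_singletonD(3)[OF f mem(2)] by blast
  then have "x \<in> e - f'" using f1(1) by simp
  then have "v = x" using f'(4) by simp
  show "z \<in> {x, y}"
  proof (rule ccontr)
    assume "z \<notin> {x, y}"
    then have "z \<notin> e - f" "z \<notin> e - f'"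
      using f1(4) f'(4) \<open>f1 = f\<close> \<open>u = y\<close> \<open>v = x\<close> by simp_all
    then have "z \<in> f" "z \<in> f'" using f''(1) by simp_all
    then show False
      using star_singletonD(3)[OF f''(3)] mem \<open>f \<noteq> f'\<close> by metis
  qed
qed

lemma tight_card_le_2:
  assumes "e \<in> A" "x \<in> tight A B e" "star B x = {f}" "y \<in> tight A B e" "y \<notin> f"
  shows "card (tight A B e) \<le> 2"
proof -
  have "card (tight A B e) \<le> card {x, y}"
    by (rule card_mono[OF _ tight_subset_pair[OF assms]]) simp
  also have "\<dots> \<le> 2" by (simp add: card_insert_if)
  finally show ?thesis .
qed

text \<open>This keeps the denominator in \<open>share\<close> positive. If all of \<open>e\<close>
  were tight, so would be the vertex of \<open>e\<close> missed by the \<open>B\<close>-hyperedge of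
  a tight vertex, and at most two vertices could be tight.\<close>

lemma card_tight_less:
  assumes e: "e \<in> A"
  shows "card (tight A B e) < d"
proof (rule ccontr)
  assume "\<not> card (tight A B e) < d"
  then have big: "card (tight A B e) \<ge> d" by simp
  then have eq: "tight A B e = e"
    using card_seteq[OF _ tight_subset, of e A B] finite_edge unifA e by simp
  have "e \<noteq> {}" using unifA[OF e] d_ge by auto
  then obtain x where x: "x \<in> tight A B e" using eq by auto
  obtain f y where f: "x \<in> e" "star A x = {e}" "star B x = {f}" "e - f = {y}"
    by (rule tightE[OF e x])
  have "y \<in> tight A B e" "y \<notin> f" using f eq by auto
  from tight_card_le_2[OF e x f(3) this] show False using big d_ge by simp
qed

text \<open>The \<open>B\<close>-hyperedge of a tight vertex \<open>y\<close> cannot contain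
  \<open>x\<close>: otherwise the vertex of \<open>e\<close> that it misses would be tight, leaving
  at most two tight vertices. Hence \<open>B\<close> joins \<open>x\<close> to no other vertex of
  \<open>e\<close>, while \<open>e\<close> joins it to all of them.\<close>

lemma discrepancy_of_full_tight:
  assumes e: "e \<in> A" and c: "card (tight A B e) = d - 1" and x: "x \<in> e" "x \<notin> tight A B e"
  shows "card (discrepancy A B x) \<ge> d - 1"
proof -
  have fe: "finite e" using finite_edge e by auto
  have ce: "card (e - {x}) = d - 1" using unifA[OF e] x fe by simp
  have eq: "tight A B e = e - {x}"
    by (rule card_seteq) (use fe x tight_subset[of A B e] c ce in auto)
  have "e - {x} \<subseteq> discrepancy A B x"
  proof
    fix y assume y: "y \<in> e - {x}"
    then have yt: "y \<in> tight A B e" using eq by simp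
    obtain f z where f: "y \<in> e" "star A y = {e}" "star B y = {f}" "e - f = {z}"
      by (rule tightE[OF e yt])
    have "x \<notin> f"
    proof
      assume "x \<in> f"
      then have "z \<in> tight A B e" "z \<notin> f" using f eq by auto
      from tight_card_le_2[OF e yt f(3) this] show False using c d_ge by simp
    qed
    then have "y \<notin> link B x"
      using star_singletonD(3)[OF f(3)] by (auto simp: link_def star_def)
    moreover have "y \<in> link A x" using y x e by (auto simp: link_def star_def)
    ultimately show "y \<in> discrepancy A B x" by (simp add: discrepancy_def)
  qed
  from card_mono[OF finite_discrepancy this] ce show ?thesis by simp
qed

section \<open>Lower bounds on shares and the total budget of a hyperedge\<close>

lemma share_mono:
  assumes e: "e \<in> A" and m: "card (tight A B e) \<le> d - m" "m > 0" "m \<le> d"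
  shows "share A B e x \<ge> real d - 2 - (real d - 5) / (2 * real m)"
proof -
  have "real m \<le> real d - real (card (tight A B e))" using m by linarith
  then have "(real d - 5) / (2 * (real d - real (card (tight A B e)))) \<le> (real d - 5) / (2 * real m)"
    using m d_ge by (intro divide_left_mono) auto
  moreover have "0 \<le> (real d - 5) / (2 * real m)" using d_ge by simp
  ultimately show ?thesis using unifA[OF e] by (simp add: share_def)
qed

lemma share_ge:
  assumes e: "e \<in> A"
  shows "share A B e x \<ge> (real d + 1) / 2"
proof -
  have "card (tight A B e) \<le> d - 1" using card_tight_less[OF e] by linarith
  from share_mono[OF e this, of x] d_ge show ?thesis by (simp add: field_simps)
qed

text \<open>At least two vertices are not tight, so the deduction is at most
  \<open>(d - 5) / 4\<close>. The bound is chosen so that three hyperedges at a vertex pay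
  \<open>2 * d - 1\<close>.\<close>

lemma share_ge_third:
  assumes e: "e \<in> A" and c: "card (tight A B e) \<le> d - 2"
  shows "share A B e x \<ge> (2 * real d - 1) / 3"
proof -
  have "share A B e x \<ge> real d - 2 - (real d - 5) / 4"
    using share_mono[OF e c, of x] d_ge by simp
  moreover have "(2 * real d - 1) / 3 \<le> real d - 2 - (real d - 5) / 4"
    using d_ge by (simp add: field_simps)
  ultimately show ?thesis by (rule order_trans[rotated])
qed

lemma sum_share:
  assumes e: "e \<in> A"
  shows "(\<Sum>x\<in>e. share A B e x) = (2 * (real d)\<^sup>2 - 5 * real d + 5) / 2"
proof -
  let ?T = "tight A B e"
  define k where "k = real d - real (card ?T)"
  have fe: "finite e" by (rule finite_edge) (simp add: e)
  have lt: "card ?T < d" by (rule card_tight_less[OF e])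
  then have k: "k > 0" by (simp add: k_def)
  have c: "real (card (e - ?T)) = k"
    using card_Diff_subset[OF finite_tight[OF e] tight_subset] unifA[OF e] lt
    by (simp add: k_def of_nat_diff)
  have "(\<Sum>x\<in>e. share A B e x) = (\<Sum>x\<in>e - ?T. share A B e x) + (\<Sum>x\<in>?T. share A B e x)"
    by (rule sum.subset_diff[OF tight_subset fe])
  also have "(\<Sum>x\<in>e - ?T. share A B e x) = (\<Sum>x\<in>e - ?T. real d - 2 - (real d - 5) / (2 * k))"
    by (rule sum.cong) (simp_all add: share_def unifA[OF e] k_def)
  also have "\<dots> = k * (real d - 2 - (real d - 5) / (2 * k))" by (simp add: c)
  also have "\<dots> = k * (real d - 2) - (real d - 5) / 2"
    using k by (simp add: field_simps)
  also have "(\<Sum>x\<in>?T. share A B e x) = (\<Sum>x\<in>?T. real d - 2)"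
    by (rule sum.cong) (simp_all add: share_def unifA[OF e])
  also have "\<dots> = (real d - k) * (real d - 2)" by (simp add: k_def)
  also have "k * (real d - 2) - (real d - 5) / 2 + (real d - k) * (real d - 2)
      = real d * (real d - 2) - (real d - 5) / 2"
    by (simp add: algebra_simps)
  finally show ?thesis by (simp add: field_simps power2_eq_square)
qed

section \<open>The charge at each vertex\<close>

definition charge :: "'a \<Rightarrow> real" where
  "charge x = (\<Sum>e\<in>star A x. share A B e x) + (\<Sum>f\<in>star B x. share B A f x)
     + 3 / 2 * real (card (discrepancy A B x))"

lemma sum_share_ge:
  "(\<Sum>e\<in>star A x. share A B e x) \<ge> real (card (star A x)) * ((real d + 1) / 2)"
proof -
  have "(\<Sum>e\<in>star A x. (real d + 1) / 2) \<le> (\<Sum>e\<in>star A x. share A B e x)"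
    by (rule sum_mono, rule share_ge) (simp add: star_def)
  then show ?thesis by simp
qed

text \<open>One hyperedge of \<open>A\<close> pays at least \<open>(d + 1) / 2\<close> and the
  discrepancy adds at least \<open>3 / 2 * (d - 1)\<close>; these sum to exactly
  \<open>2 * d - 1\<close>.\<close>

lemma charge_ge_of_discrepancy:
  assumes "star A x \<noteq> {}" "card (discrepancy A B x) \<ge> d - 1"
  shows "charge x \<ge> 2 * real d - 1"
proof -
  have "1 \<le> card (star A x)" using assms(1) finite_star(1) by (simp add: Suc_le_eq card_gt_0_iff)
  then have "1 * ((real d + 1) / 2) \<le> real (card (star A x)) * ((real d + 1) / 2)"
    by (intro mult_right_mono) auto
  also note sum_share_ge[of x]
  finally have "(real d + 1) / 2 \<le> (\<Sum>e\<in>star A x. share A B e x)" by simp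
  moreover have "0 \<le> (\<Sum>f\<in>star B x. share B A f x)"
  proof (rule sum_nonneg)
    fix f assume "f \<in> star B x"
    then have "f \<in> B" by (simp add: star_def)
    from uniform_pair.share_ge[OF swap this, of x] show "0 \<le> share B A f x" by simp
  qed
  moreover have "real (card (discrepancy A B x)) \<ge> real d - 1" using assms(2) d_ge by linarith
  ultimately show ?thesis unfolding charge_def by (simp add: field_simps)
qed

lemma charge_ge_of_star_empty:
  assumes "star A x \<noteq> {}" "star B x = {}"
  shows "charge x \<ge> 2 * real d - 1"
proof (rule charge_ge_of_discrepancy[OF assms(1)])
  obtain e where e: "e \<in> A" "x \<in> e" using assms by (auto simp: star_def)
  have "e - {x} \<subseteq> discrepancy A B x"
    using e assms(2) by (auto simp: discrepancy_def link_def star_def)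
  from card_mono[OF finite_discrepancy this]
  show "d - 1 \<le> card (discrepancy A B x)" using unifA[OF e(1)] e(2) by simp
qed

text \<open>If all vertices of \<open>e\<close> but \<open>x\<close> were tight, the discrepancy at
  \<open>x\<close> would already force the charge up to \<open>2 * d - 1\<close>.\<close>

lemma share_ge_third_or_charge:
  assumes "e \<in> star A x" "x \<notin> tight A B e" "charge x < 2 * real d - 1"
  shows "share A B e x \<ge> (2 * real d - 1) / 3"
proof -
  have e: "e \<in> A" "x \<in> e" using assms by (auto simp: star_def)
  have "card (tight A B e) \<noteq> d - 1"
    using discrepancy_of_full_tight[OF e(1) _ e(2) assms(2)] charge_ge_of_discrepancy assms by force
  then have "card (tight A B e) \<le> d - 2" using card_tight_less[OF e(1)] by linarith
  then show ?thesis by (rule share_ge_third[OF e(1)])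
qed

lemma card_discrepancy_singletons:
  assumes "star A x = {e}" "star B x = {f}"
  shows "card (discrepancy A B x) = 2 * (d - card (e \<inter> f))"
proof -
  have mem: "e \<in> A" "f \<in> B" "x \<in> e" "x \<in> f"
    using star_singletonD(1,2)[OF assms(1)] star_singletonD(1,2)[OF assms(2)] by simp_all
  then have fine: "finite e" "finite f" using finite_edge by auto
  have "discrepancy A B x = (e - f) \<union> (f - e)"
    using assms mem by (auto simp: discrepancy_def link_def)
  also have "card \<dots> = card (e - f) + card (f - e)"
    using fine by (intro card_Un_disjoint) auto
  also have "card (e - f) = d - card (e \<inter> f)"
    using fine unifA mem by (simp add: card_Diff_subset_Int)
  also have "card (f - e) = d - card (e \<inter> f)"
    using fine unifB mem by (simp add: card_Diff_subset_Int Int_commute)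
  finally show ?thesis by simp
qed

text \<open>A tight vertex in \<open>e \<inter> f\<close> would have \<open>f\<close> as its only
  \<open>B\<close>-hyperedge, so \<open>e \<inter> f\<close> would have \<open>d - 1\<close>
  elements and \<open>x\<close> would be tight too. All tight vertices therefore lie in
  \<open>e - f\<close>.\<close>

lemma card_tight_le_of_not_tight:
  assumes "star A x = {e}" "star B x = {f}" "x \<notin> tight A B e"
  shows "card (tight A B e) \<le> d - card (e \<inter> f)"
proof -
  have mem: "e \<in> A" "f \<in> B" "x \<in> e" "x \<in> f"
    using star_singletonD(1,2)[OF assms(1)] star_singletonD(1,2)[OF assms(2)] by simp_all
  then have fine: "finite e" using finite_edge by auto
  have "tight A B e \<subseteq> e - f"
  proof
    fix y assume y: "y \<in> tight A B e"
    then obtain f' where f': "y \<in> e" "star B y = {f'}" "Suc (card (e \<inter> f')) = card e"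
      by (auto simp: tight_def)
    have "y \<notin> f"
    proof
      assume "y \<in> f"
      then have "f = f'" by (rule star_singletonD(3)[OF f'(2) mem(2)])
      then show False using assms f' mem by (auto simp: tight_def)
    qed
    with f' show "y \<in> e - f" by simp
  qed
  from card_mono[OF _ this] show ?thesis
    using fine unifA mem by (simp add: card_Diff_subset_Int)
qed

lemma charge_ge_of_singletons:
  assumes s: "star A x = {e}" "star B x = {f}"
  shows "charge x \<ge> 2 * real d - 1"
proof -
  interpret swapped: uniform_pair d B A by (rule swap)
  have mem: "e \<in> A" "f \<in> B" "x \<in> e" "x \<in> f"
    using star_singletonD(1,2)[OF s(1)] star_singletonD(1,2)[OF s(2)] by simp_all
  then have fine: "finite e" "finite f" using finite_edge by auto
  define m where "m = card (e \<inter> f)"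
  have ce: "card e = d" "card f = d" using mem unifA unifB by auto
  have m0: "m > 0" unfolding m_def using mem fine by (auto simp: card_gt_0_iff)
  have "e \<noteq> f" using mem disj by blast
  then have "\<not> e \<subseteq> f" using card_subset_eq[OF fine(2)] ce by metis
  then have "e \<inter> f \<subset> e" by blast
  then have md: "m < d" unfolding m_def using psubset_card_mono fine ce by metis
  have disc: "real (card (discrepancy A B x)) = 2 * (real d - real m)"
    using card_discrepancy_singletons[OF s] md by (simp add: m_def[symmetric] of_nat_diff)
  have ch: "charge x = share A B e x + share B A f x + 3 * (real d - real m)"
    using s disc by (simp add: charge_def)
  have tights: "x \<in> tight A B e \<longleftrightarrow> Suc m = d" "x \<in> tight B A f \<longleftrightarrow> Suc m = d"
    using s mem ce by (auto simp: tight_def m_def Int_commute)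
  show ?thesis
  proof (cases "Suc m = d")
    \<comment> \<open>Both shares are \<open>d - 2\<close> and the two discrepancy vertices add
      \<open>3\<close>, which gives exactly \<open>2 * d - 1\<close>.\<close>
    case True
    then have "real d - real m = 1" by linarith
    with True tights ch ce show ?thesis by (simp add: share_def)
  next
    case False
    have "x \<notin> tight A B e" "x \<notin> tight B A f" using tights False by simp_all
    then have le: "card (tight A B e) \<le> d - m" "card (tight B A f) \<le> d - m"
      using card_tight_le_of_not_tight[OF s] swapped.card_tight_le_of_not_tight[OF s(2,1)]
      by (simp_all add: m_def Int_commute)
    have "m \<le> d" using md by simp
    from add_mono[OF share_mono[OF mem(1) le(1) m0 this, of x]
        swapped.share_mono[OF mem(2) le(2) m0 this, of x]]
    have "2 * (real d - 2 - (real d - 5) / (2 * real m)) \<le> share A B e x + share B A f x"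
      by (simp only: mult_2[of "real d - 2 - (real d - 5) / (2 * real m)"])
    also have "2 * (real d - 2 - (real d - 5) / (2 * real m)) = 2 * (real d - 2) - (real d - 5) / real m"
      using m0 by (simp add: field_simps)
    finally have 1: "2 * (real d - 2) - (real d - 5) / real m \<le> share A B e x + share B A f x" .
    \<comment> \<open>Here \<open>1 \<le> m \<le> d - 2\<close>, and the product expands to
      \<open>m * (d - m - 1) \<ge> d - 2\<close>, which leaves room to absorb both
      deductions.\<close>
    have "(real m - 1) * (real d - 2 - real m) \<ge> 0"
      using m0 md False by (intro mult_nonneg_nonneg) linarith+
    then have "real d - 5 \<le> 3 * (real d - real m - 1) * real m"
      using d_ge by (simp add: algebra_simps)
    then have "(real d - 5) / real m \<le> 3 * (real d - real m - 1)"
      using m0 by (simp add: field_simps)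
    from add_mono[OF 1 this] ch show ?thesis by (simp add: algebra_simps)
  qed
qed

lemma charge_swap: "uniform_pair.charge B A x = charge x"
  unfolding uniform_pair.charge_def[OF swap] charge_def by (simp add: discrepancy_commute[of B A])

lemma charge_ge:
  assumes "x \<in> \<Union>(A \<union> B)"
  shows "charge x \<ge> 2 * real d - 1"
proof -
  interpret swapped: uniform_pair d B A by (rule swap)
  have eq: "swapped.charge x = charge x" by (rule charge_swap)
  consider "star B x = {}" | "star A x = {}" | e f where "star A x = {e}" "star B x = {f}"
    | "star A x \<noteq> {}" "star B x \<noteq> {}" "\<not> (\<exists>e f. star A x = {e} \<and> star B x = {f})" by blast
  then show ?thesis
  proof cases
    case 1
    moreover have "star A x \<noteq> {}" using assms 1 by (auto simp: star_def)
    ultimately show ?thesis by (simp add: charge_ge_of_star_empty)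
  next
    case 2
    moreover have "star B x \<noteq> {}" using assms 2 by (auto simp: star_def)
    ultimately show ?thesis using swapped.charge_ge_of_star_empty[of x] eq by simp
  next
    case 3
    then show ?thesis by (rule charge_ge_of_singletons)
  next
    \<comment> \<open>At least three hyperedges meet \<open>x\<close>, and \<open>x\<close> is tight
      in none of them, since tightness needs exactly one hyperedge of each family. Unless the charge
      suffices already, each pays a third of the target.\<close>
    case 4
    show ?thesis
    proof (rule ccontr)
      assume "\<not> ?thesis"
      then have lt: "charge x < 2 * real d - 1" by simp
      have A3: "(2 * real d - 1) / 3 \<le> share A B e x" if "e \<in> star A x" for e
        using share_ge_third_or_charge[OF that _ lt] 4 by (auto simp: tight_def)
      have B3: "(2 * real d - 1) / 3 \<le> share B A e x" if "e \<in> star B x" for e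
        using swapped.share_ge_third_or_charge[OF that] eq lt 4 by (auto simp: tight_def)
      have "card (star A x) \<noteq> 0" "card (star B x) \<noteq> 0" using 4 finite_star by auto
      moreover have "\<not> (card (star A x) = 1 \<and> card (star B x) = 1)"
        using 4 by (auto simp: card_1_singleton_iff)
      ultimately have "3 \<le> card (star A x) + card (star B x)" by linarith
      then have "3 * ((2 * real d - 1) / 3)
          \<le> real (card (star A x) + card (star B x)) * ((2 * real d - 1) / 3)"
        using d_ge by (intro mult_right_mono) auto
      also have "\<dots> \<le> (\<Sum>e\<in>star A x. share A B e x) + (\<Sum>f\<in>star B x. share B A f x)"
        using sum_mono[of "star A x" "\<lambda>_. (2 * real d - 1) / 3" "\<lambda>e. share A B e x", OF A3]
          sum_mono[of "star B x" "\<lambda>_. (2 * real d - 1) / 3" "\<lambda>f. share B A f x", OF B3]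
        by (simp add: distrib_right)
      also have "\<dots> \<le> charge x" by (simp add: charge_def)
      finally show False using lt by simp
    qed
  qed
qed

section \<open>Double counting of the charges over the support\<close>

lemma finite_support: "finite (\<Union>(A \<union> B))"
  using fin finite_edge by auto

lemma sum_star_share:
  "(\<Sum>x\<in>\<Union>(A \<union> B). \<Sum>e\<in>star A x. share A B e x) = real (card A) * ((2 * (real d)\<^sup>2 - 5 * real d + 5) / 2)"
proof -
  have "(\<Sum>x\<in>\<Union>(A \<union> B). \<Sum>e\<in>star A x. share A B e x)
      = (\<Sum>e\<in>A. \<Sum>x\<in>{x \<in> \<Union>(A \<union> B). x \<in> e}. share A B e x)"
    unfolding star_def by (rule sum.swap_restrict[OF finite_support fin(1)])
  also have "\<dots> = (\<Sum>e\<in>A. \<Sum>x\<in>e. share A B e x)"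
    by (intro sum.cong) auto
  also have "\<dots> = (\<Sum>e\<in>A. (2 * (real d)\<^sup>2 - 5 * real d + 5) / 2)"
    by (intro sum.cong sum_share) auto
  finally show ?thesis by simp
qed

lemma card_support_le:
  "(2 * real d - 1) * real (card (\<Union>(A \<union> B)))
     \<le> (2 * (real d)\<^sup>2 - 5 * real d + 5) * (real (card A) + real (card B)) / 2
       + 3 / 2 * (\<Sum>x\<in>\<Union>(A \<union> B). real (card (discrepancy A B x)))"
proof -
  interpret swapped: uniform_pair d B A by (rule swap)
  have "(2 * real d - 1) * real (card (\<Union>(A \<union> B))) = (\<Sum>x\<in>\<Union>(A \<union> B). 2 * real d - 1)" by simp
  also have "\<dots> \<le> (\<Sum>x\<in>\<Union>(A \<union> B). charge x)" by (rule sum_mono[OF charge_ge])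
  also have "\<dots> = (\<Sum>x\<in>\<Union>(A \<union> B). \<Sum>e\<in>star A x. share A B e x)
      + (\<Sum>x\<in>\<Union>(B \<union> A). \<Sum>e\<in>star B x. share B A e x)
      + 3 / 2 * (\<Sum>x\<in>\<Union>(A \<union> B). real (card (discrepancy A B x)))"
    by (simp add: charge_def sum.distrib sum_distrib_left Un_commute)
  also have "\<dots> = (2 * (real d)\<^sup>2 - 5 * real d + 5) * (real (card A) + real (card B)) / 2
       + 3 / 2 * (\<Sum>x\<in>\<Union>(A \<union> B). real (card (discrepancy A B x)))"
    unfolding sum_star_share swapped.sum_star_share by (simp add: field_simps)
  finally show ?thesis .
qed

end

section \<open>Common hyperedges and the dense subhypergraph\<close>

lemma common_edge_bound:
  fixes w d :: real
  assumes "5 \<le> d" "2 \<le> w" "w \<le> d"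
  shows "3 / 2 * (w * (w - 1)) \<le> (2 * d - 1) * (w - 2) + 3"
proof -
  \<comment> \<open>Twice the difference of the two sides; the second factor is at least
    \<open>d - 5\<close>.\<close>
  have "(w - 2) * (4 * d - 5 - 3 * w) \<ge> 0"
    using assms by (intro mult_nonneg_nonneg) auto
  then show ?thesis by (simp add: field_simps)
qed

lemma Proj_pair_iff:
  assumes "x \<noteq> y"
  shows "{x, y} \<in> hedges (Proj H) \<longleftrightarrow> (\<exists>e\<in>hedges H. x \<in> e \<and> y \<in> e)"
  using assms by (auto simp: Proj_def doubleton_eq_iff)

lemma max_density_ge:
  assumes "hypergraph H" "subhypergraph K H" "verts K \<noteq> {}"
  shows "real (num_edges K) / real (num_verts K) \<le> max_density H"
  unfolding max_density_def
proof (rule Max_ge)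
  have "{real (num_edges K) / real (num_verts K) | K. subhypergraph K H \<and> verts K \<noteq> {}}
      \<subseteq> (\<lambda>K. real (num_edges K) / real (num_verts K)) ` {K. subhypergraph K H}" by auto
  then show "finite {real (num_edges K) / real (num_verts K) | K. subhypergraph K H \<and> verts K \<noteq> {}}"
    using finite_subhypergraphs[OF assms(1)] finite_surj by blast
qed (use assms in blast)

theorem theorem36:
  fixes d :: nat and h g :: "'a hypergraph"
  assumes "d \<ge> 5"
    and "uniform_hypergraph d h"
    and "uniform_hypergraph d g"
    and "verts h = verts g"
    and "h \<noteq> g"
    and "Proj h = Proj g"
    and "num_edges h \<ge> num_edges g"
  shows "real d - 1 - 1 / max_density h \<ge> (2 * real d - 4) / (2 * real d - 1)"
proof -
  define A where "A = hedges h - hedges g"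
  define B where "B = hedges g - hedges h"
  define W where "W = \<Union>(A \<union> B)"
  define C where "C = {c \<in> hedges h \<inter> hedges g. 2 \<le> card (c \<inter> W)}"
  define K where "K = \<lparr>verts = \<Union>(A \<union> C), hedges = A \<union> C\<rparr>"
  have hyp: "hypergraph h" "hypergraph g"
    using assms(2,3) by (auto simp: uniform_hypergraph_def)
  have sub: "hedges h \<subseteq> Pow (verts h)" "hedges g \<subseteq> Pow (verts h)" and finV: "finite (verts h)"
    using hyp assms(4) by (auto simp: hypergraph_def)
  have finE: "finite (hedges h)" "finite (hedges g)"
    using sub finV by (meson finite_Pow_iff finite_subset)+
  have unif: "card e = d" if "e \<in> hedges h \<union> hedges g" for e
    using assms(2,3) that by (auto simp: uniform_hypergraph_def)
  have finAC: "finite A" "finite B" "finite C" using finE by (auto simp: A_def B_def C_def)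
  interpret uniform_pair d A B
  proof
    show "d \<ge> 5" "finite A" "finite B" by fact+
    show "card e = d" if "e \<in> A" for e using unif that by (simp add: A_def)
    show "card e = d" if "e \<in> B" for e using unif that by (simp add: B_def)
    show "A \<inter> B = {}" by (auto simp: A_def B_def)
  qed
  have AB: "card B \<le> card A"
  proof -
    have "card (hedges h) = card A + card (hedges h \<inter> hedges g)"
      "card (hedges g) = card B + card (hedges h \<inter> hedges g)"
      using finE card_Int_Diff[of "hedges h" "hedges g"] card_Int_Diff[of "hedges g" "hedges h"]
      by (simp_all add: A_def B_def Int_commute)
    then show ?thesis using assms(7) by (simp add: num_edges_def)
  qed
  have Ane: "A \<noteq> {}"
  proof
    assume "A = {}"
    then have "B = {}" using AB finAC by simp
    with \<open>A = {}\<close> have "hedges h = hedges g" by (auto simp: A_def B_def)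
    with assms(4,5) show False by (simp add: hypergraph.equality)
  qed
  have finW: "finite W" using finite_support by (simp add: W_def)
  have finc: "finite c" "card c = d" if "c \<in> C" for c
  proof -
    have "c \<in> hedges h" using that by (simp add: C_def)
    then show "finite c" "card c = d" using sub(1) finV unif by (auto intro: finite_subset)
  qed
  have disc: "discrepancy A B x \<subseteq> (\<Union>c\<in>{c\<in>C. x \<in> c}. c \<inter> W - {x})" if "x \<in> W" for x
  proof
    fix y assume y: "y \<in> discrepancy A B x"
    have xy: "x \<noteq> y" and yW: "y \<in> W"
      using y by (auto simp: discrepancy_def link_def star_def W_def)
    have iff: "(\<exists>e\<in>hedges h. x \<in> e \<and> y \<in> e) \<longleftrightarrow> (\<exists>e\<in>hedges g. x \<in> e \<and> y \<in> e)"
      using Proj_pair_iff[OF xy] assms(6) by metis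
    \<comment> \<open>The pair lies in a hyperedge of one of \<open>A\<close>, \<open>B\<close> and
      in none of the other. Equal projections make the other hypergraph cover it too, and only a
      common hyperedge can do so.\<close>
    have "\<exists>c\<in>hedges h \<inter> hedges g. x \<in> c \<and> y \<in> c"
      using y iff by (auto simp: discrepancy_def link_def star_def A_def B_def)
    then obtain c where c: "c \<in> hedges h \<inter> hedges g" "x \<in> c" "y \<in> c" by blast
    have "card {x, y} \<le> card (c \<inter> W)"
      using c yW that finW by (intro card_mono) auto
    then have "c \<in> C" using c xy by (simp add: C_def)
    then show "y \<in> (\<Union>c\<in>{c\<in>C. x \<in> c}. c \<inter> W - {x})" using c xy yW by blast
  qed
  have "(\<Sum>x\<in>W. real (card (discrepancy A B x))) \<le> (\<Sum>x\<in>W. \<Sum>c\<in>{c\<in>C. x \<in> c}. real (card (c \<inter> W)) - 1)"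
  proof (rule sum_mono)
    fix x assume x: "x \<in> W"
    have "card (discrepancy A B x) \<le> card (\<Union>c\<in>{c\<in>C. x \<in> c}. c \<inter> W - {x})"
      using finAC finW by (intro card_mono disc x) auto
    also have "\<dots> \<le> (\<Sum>c\<in>{c\<in>C. x \<in> c}. card (c \<inter> W - {x}))"
      using finAC by (intro card_UN_le) auto
    finally have "real (card (discrepancy A B x)) \<le> (\<Sum>c\<in>{c\<in>C. x \<in> c}. real (card (c \<inter> W - {x})))"
      using of_nat_mono by fastforce
    also have "\<dots> = (\<Sum>c\<in>{c\<in>C. x \<in> c}. real (card (c \<inter> W)) - 1)"
    proof (rule sum.cong)
      fix c assume "c \<in> {c\<in>C. x \<in> c}"
      then show "real (card (c \<inter> W - {x})) = real (card (c \<inter> W)) - 1"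
        using x finW by (auto simp: C_def of_nat_diff)
    qed simp
    finally show "real (card (discrepancy A B x)) \<le> (\<Sum>c\<in>{c\<in>C. x \<in> c}. real (card (c \<inter> W)) - 1)" .
  qed
  \<comment> \<open>After exchanging the sums, each \<open>c\<close> counts the ordered pairs of
    distinct vertices in \<open>c \<inter> W\<close>.\<close>
  also have "\<dots> = (\<Sum>c\<in>C. \<Sum>x\<in>{x\<in>W. x \<in> c}. real (card (c \<inter> W)) - 1)"
    by (rule sum.swap_restrict[OF finW finAC(3)])
  also have "\<dots> = (\<Sum>c\<in>C. real (card (c \<inter> W)) * (real (card (c \<inter> W)) - 1))"
  proof (rule sum.cong)
    fix c
    have "{x\<in>W. x \<in> c} = c \<inter> W" by auto
    then show "(\<Sum>x\<in>{x\<in>W. x \<in> c}. real (card (c \<inter> W)) - 1)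
        = real (card (c \<inter> W)) * (real (card (c \<inter> W)) - 1)" by simp
  qed simp
  finally have "3 / 2 * (\<Sum>x\<in>W. real (card (discrepancy A B x)))
      \<le> (\<Sum>c\<in>C. 3 / 2 * (real (card (c \<inter> W)) * (real (card (c \<inter> W)) - 1)))"
    unfolding sum_distrib_left[symmetric] by simp
  also have "\<dots> \<le> (\<Sum>c\<in>C. (2 * real d - 1) * (real (card (c \<inter> W)) - 2) + 3)"
  proof (intro sum_mono common_edge_bound)
    fix c assume c: "c \<in> C"
    show "5 \<le> real d" "2 \<le> real (card (c \<inter> W))" using assms(1) c by (auto simp: C_def)
    show "real (card (c \<inter> W)) \<le> real d"
      using card_mono[of c "c \<inter> W"] finc[OF c] by simp
  qed
  finally have disc_sum: "3 / 2 * (\<Sum>x\<in>W. real (card (discrepancy A B x)))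
      \<le> (\<Sum>c\<in>C. (2 * real d - 1) * (real (card (c \<inter> W)) - 2) + 3)" .
  \<comment> \<open>A hyperedge of \<open>A\<close> or \<open>B\<close> has budget
    \<open>q / 2\<close>. Also \<open>q = (2 * d - 1) * (d - 2) + 3\<close>, which will be the full
    cost of a hyperedge of \<open>C\<close>.\<close>
  define q where "q = 2 * (real d)\<^sup>2 - 5 * real d + 5"
  have q_pos: "q > 0"
  proof -
    have "5 * real d \<le> real d * real d" using assms(1) by (intro mult_right_mono) auto
    then show ?thesis unfolding q_def power2_eq_square using assms(1) by linarith
  qed
  have "\<Union>(A \<union> C) \<subseteq> W \<union> (\<Union>c\<in>C. c - W)" by (auto simp: W_def)
  then have "card (\<Union>(A \<union> C)) \<le> card (W \<union> (\<Union>c\<in>C. c - W))"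
    using finW finAC finc by (intro card_mono) auto
  also have "\<dots> \<le> card W + (\<Sum>c\<in>C. card (c - W))"
    using card_Un_le[of W "\<Union>c\<in>C. c - W"] card_UN_le[OF finAC(3), of "\<lambda>c. c - W"] by linarith
  finally have "real (card (\<Union>(A \<union> C))) \<le> real (card W) + (\<Sum>c\<in>C. real (card (c - W)))"
    using of_nat_mono by fastforce
  also have "(\<Sum>c\<in>C. real (card (c - W))) = (\<Sum>c\<in>C. real d - real (card (c \<inter> W)))"
  proof (rule sum.cong)
    fix c assume c: "c \<in> C"
    have "card (c \<inter> W) \<le> card c" using finc[OF c] by (intro card_mono) auto
    then show "real (card (c - W)) = real d - real (card (c \<inter> W))"
      using finc[OF c] by (simp add: card_Diff_subset_Int of_nat_diff)
  qed simp
  finally have "(2 * real d - 1) * real (card (\<Union>(A \<union> C)))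
      \<le> (2 * real d - 1) * (real (card W) + (\<Sum>c\<in>C. real d - real (card (c \<inter> W))))"
    using assms(1) by (intro mult_left_mono) auto
  also have "\<dots> \<le> q * (real (card A) + real (card B)) / 2
      + (\<Sum>c\<in>C. (2 * real d - 1) * (real (card (c \<inter> W)) - 2) + 3)
      + (\<Sum>c\<in>C. (2 * real d - 1) * (real d - real (card (c \<inter> W))))"
    unfolding distrib_left sum_distrib_left[symmetric]
    using card_support_le[folded W_def q_def] disc_sum by (simp add: distrib_left)
  \<comment> \<open>The dependence on \<open>card (c \<inter> W)\<close> cancels: what
    \<open>c\<close> adds through discrepancies and through its vertices outside \<open>W\<close> is
    together bounded by \<open>q\<close>.\<close>
  also have "\<dots> = q * (real (card A) + real (card B)) / 2 + (\<Sum>c\<in>C. q)"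
    by (simp add: sum.distrib[symmetric] add.assoc) (auto intro!: sum.cong simp: q_def algebra_simps power2_eq_square)
  also have "\<dots> \<le> q * (real (card A) + real (card C))"
  proof -
    have "q * real (card B) \<le> q * real (card A)" using AB q_pos by simp
    then show ?thesis by (simp add: algebra_simps)
  qed
  also have "real (card A) + real (card C) = real (card (A \<union> C))"
    using finAC by (subst card_Un_disjoint) (auto simp: A_def C_def)
  finally have main: "(2 * real d - 1) * real (num_verts K) \<le> q * real (num_edges K)"
    by (simp add: K_def num_verts_def num_edges_def)
  have K: "subhypergraph K h"
    using sub finV finite_subset[of "\<Union>(A \<union> C)" "verts h"]
    by (fastforce simp: subhypergraph_def hypergraph_def K_def A_def C_def)
  obtain e where e: "e \<in> A" using Ane by blast
  have "e \<noteq> {}" using unifA[OF e] assms(1) by auto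
  then have Kne: "verts K \<noteq> {}" using e by (auto simp: K_def)
  have finK: "finite (verts K)" using K finV by (auto simp: subhypergraph_def hypergraph_def)
  have pos: "real (num_verts K) > 0" "real (num_edges K) > 0"
    using Kne finK Ane finAC by (auto simp: num_verts_def num_edges_def K_def card_gt_0_iff)
  have d0: "2 * real d - 1 > 0" using assms(1) by simp
  have "(2 * real d - 1) / q \<le> real (num_edges K) / real (num_verts K)"
    using main pos q_pos by (simp add: field_simps)
  also have "\<dots> \<le> max_density h" by (rule max_density_ge[OF hyp(1) K Kne])
  \<comment> \<open>The lower bound \<open>(2 * d - 1) / q\<close> is positive, so
    \<open>max_density h\<close> is not zero and taking reciprocals reverses the inequality.\<close>
  finally have "1 / max_density h \<le> 1 / ((2 * real d - 1) / q)"
    using d0 q_pos by (intro frac_le) simp_all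
  then have "1 / max_density h \<le> q / (2 * real d - 1)" by simp
  moreover have "q / (2 * real d - 1) = real d - 1 - (2 * real d - 4) / (2 * real d - 1)"
    using d0 by (simp add: q_def field_simps power2_eq_square)
  ultimately show ?thesis by simp
qed

end
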